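(* Let $\varepsilon\in(0,1]$ and let $S(\tau,t)$ be a random service process of a system whose arrivals $A$ and departures $D$ satisfy $D(t)\ge\inf_{\tau\in[0,t]}\{A(\tau)+S(\tau,t)\}$ for all $t\ge 0$. Let $\mathcal{S}^{\varepsilon}(\tau,t)$, $t\ge\tau\ge0$, be a deterministic function such that for all $t\ge0$ $$\mathsf{P}\bigl[S(\tau,t)\ge\mathcal{S}^{\varepsilon}(\tau,t)\ \ \forall\tau\in[0,t]\bigr]\ge 1-\varepsilon.$$ Then for all $t\ge0$ $$\mathsf{P}\Bigl[D(t)\ge\inf_{\tau\in[0,t]}\{A(\tau)+\mathcal{S}^{\varepsilon}(\tau,t)\}\Bigr]\ge 1-\varepsilon .$$
   Context: A random service process $S(\tau,t)$, $t\ge\tau\ge0$, is a family of non-negative real random variables with $S(t,t)=0$ for all $t\ge0$; no stationarity is assumed. Cumulative arrivals $A(t)$ are non-negative, non-decreasing with $A(0)=0$ (possibly random); $D(t)$ denotes cumulative departures. All events whose probability is taken are assumed measurable (automatic in discrete time). *)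

theory Defs
  imports "HOL-Probability.Probability"
begin

text \<open>
  Time is either continuous or discrete; the interval \<open>[0,t]\<close> of the time domain
  \<open>T\<close> is \<open>T \<inter> {0..t}\<close>.
\<close>

definition time_domain :: "real set \<Rightarrow> bool" where
  "time_domain T \<longleftrightarrow> T = {0..} \<or> T = \<nat>"

text \<open>
  A process is curried with the outcome last: \<open>S \<tau> t \<omega>\<close> and \<open>A t \<omega>\<close>.
  Values at times outside \<open>T\<close>, or with \<open>\<tau> > t\<close>, are irrelevant.
\<close>

definition random_service_process ::
  "'w measure \<Rightarrow> real set \<Rightarrow> (real \<Rightarrow> real \<Rightarrow> 'w \<Rightarrow> real) \<Rightarrow> bool" where
  "random_service_process M T S \<longleftrightarrow>
     (\<forall>\<tau>\<in>T. \<forall>t\<in>T. \<tau> \<le> t \<longrightarrow>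
        S \<tau> t \<in> borel_measurable M \<and> (\<forall>\<omega>\<in>space M. 0 \<le> S \<tau> t \<omega>)) \<and>
     (\<forall>t\<in>T. \<forall>\<omega>\<in>space M. S t t \<omega> = 0)"

definition arrival_process ::
  "'w measure \<Rightarrow> real set \<Rightarrow> (real \<Rightarrow> 'w \<Rightarrow> real) \<Rightarrow> bool" where
  "arrival_process M T A \<longleftrightarrow>
     (\<forall>t\<in>T. A t \<in> borel_measurable M) \<and>
     (\<forall>\<omega>\<in>space M. A 0 \<omega> = 0 \<and> (\<forall>t\<in>T. 0 \<le> A t \<omega>) \<and> mono_on T (\<lambda>t. A t \<omega>))"

text \<open>
  The infimum is taken in the extended reals, since nothing forces a deterministic
  \<open>s\<close> to be bounded below on \<open>[0,t]\<close>: there the infimum may be \<open>-\<infinity>\<close>,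
  whereas the real-valued \<open>Inf\<close> would be unspecified.
\<close>

definition min_plus ::
  "real set \<Rightarrow> (real \<Rightarrow> real) \<Rightarrow> (real \<Rightarrow> real \<Rightarrow> real) \<Rightarrow> real \<Rightarrow> ereal" where
  "min_plus T a s t = (INF \<tau>\<in>T \<inter> {0..t}. ereal (a \<tau> + s \<tau> t))"

end

theory Submission
  imports Defs
begin

text \<open>The probability enters only through monotonicity of the measure. Fix \<open>t\<close>
  and an outcome at which \<open>S\<close> dominates \<open>S\<epsilon>\<close> on the whole
  interval up to \<open>t\<close>. Replacing \<open>S\<close> by \<open>S\<epsilon>\<close> can only
  lower the min-plus convolution with the arrival path (\<open>min_plus_mono\<close>), and
  \<open>D\<close> already lies above the convolution with \<open>S\<close>. So the event that the
  service bound holds is contained in the event that the departure bound holds, and the latter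
  inherits the probability 1 - \<epsilon>. The bound must hold for all \<tau> simultaneously, since
  the infimum may be approached at times that depend on the outcome.\<close>

lemma min_plus_mono:
  assumes "\<And>\<tau>. \<tau> \<in> T \<inter> {0..t} \<Longrightarrow> s \<tau> t \<le> s' \<tau> t"
  shows "min_plus T a s t \<le> min_plus T a s' t"
  \<comment> \<open>Each \<tau> on the right is matched with the same \<tau> on the left; in
    \<open>ereal\<close> no lower bound on the values is required.\<close>
  unfolding min_plus_def by (rule INF_mono) (use assms in force)

theorem mainTheorem5:
  fixes M :: "'w measure"
    and T :: "real set"
    and S :: "real \<Rightarrow> real \<Rightarrow> 'w \<Rightarrow> real"
    and A D :: "real \<Rightarrow> 'w \<Rightarrow> real"
    and S\<epsilon> :: "real \<Rightarrow> real \<Rightarrow> real"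
    and \<epsilon> :: real
  assumes "prob_space M"
    and "time_domain T"
    and "0 < \<epsilon>" and "\<epsilon> \<le> 1"
    and "random_service_process M T S"
    and "arrival_process M T A"
    and "\<forall>t\<in>T. D t \<in> borel_measurable M"
    and "\<forall>t\<in>T. \<forall>\<omega>\<in>space M.
           ereal (D t \<omega>) \<ge> min_plus T (\<lambda>\<tau>. A \<tau> \<omega>) (\<lambda>\<tau> u. S \<tau> u \<omega>) t"
    and "\<forall>t\<in>T. {\<omega>\<in>space M. \<forall>\<tau>\<in>T \<inter> {0..t}. S \<tau> t \<omega> \<ge> S\<epsilon> \<tau> t} \<in> sets M"
    and "\<forall>t\<in>T. {\<omega>\<in>space M. ereal (D t \<omega>) \<ge> min_plus T (\<lambda>\<tau>. A \<tau> \<omega>) S\<epsilon> t} \<in> sets M"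
    and "\<forall>t\<in>T. \<P>(\<omega> in M. \<forall>\<tau>\<in>T \<inter> {0..t}. S \<tau> t \<omega> \<ge> S\<epsilon> \<tau> t) \<ge> 1 - \<epsilon>"
  shows "\<forall>t\<in>T. \<P>(\<omega> in M. ereal (D t \<omega>) \<ge> min_plus T (\<lambda>\<tau>. A \<tau> \<omega>) S\<epsilon> t) \<ge> 1 - \<epsilon>"
proof
  fix t assume t: "t \<in> T"
  interpret prob_space M by fact
  have "1 - \<epsilon> \<le> \<P>(\<omega> in M. \<forall>\<tau>\<in>T \<inter> {0..t}. S \<tau> t \<omega> \<ge> S\<epsilon> \<tau> t)"
    using assms(11) t by blast
  also have "\<dots> \<le> \<P>(\<omega> in M. ereal (D t \<omega>) \<ge> min_plus T (\<lambda>\<tau>. A \<tau> \<omega>) S\<epsilon> t)"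
  proof (rule finite_measure_mono)
    show "{\<omega>\<in>space M. \<forall>\<tau>\<in>T \<inter> {0..t}. S \<tau> t \<omega> \<ge> S\<epsilon> \<tau> t}
        \<subseteq> {\<omega>\<in>space M. ereal (D t \<omega>) \<ge> min_plus T (\<lambda>\<tau>. A \<tau> \<omega>) S\<epsilon> t}"
    proof safe
      \<comment> \<open>The comparison is pathwise: with \<omega> fixed, \<open>A\<close> is an
        ordinary function of time, so its dependence on \<open>S\<close> is immaterial.\<close>
      fix \<omega> assume \<omega>: "\<omega> \<in> space M" and le: "\<forall>\<tau>\<in>T \<inter> {0..t}. S \<tau> t \<omega> \<ge> S\<epsilon> \<tau> t"
      have "min_plus T (\<lambda>\<tau>. A \<tau> \<omega>) S\<epsilon> t \<le> min_plus T (\<lambda>\<tau>. A \<tau> \<omega>) (\<lambda>\<tau> u. S \<tau> u \<omega>) t"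
        using le by (intro min_plus_mono) blast
      also have "\<dots> \<le> ereal (D t \<omega>)"
        using assms(8) t \<omega> by blast
      finally show "min_plus T (\<lambda>\<tau>. A \<tau> \<omega>) S\<epsilon> t \<le> ereal (D t \<omega>)" .
    qed
    \<comment> \<open>Monotonicity of the measure requires the larger event to be measurable. In
      continuous time this is a genuine condition, because the infimum ranges over uncountably many
      \<tau>.\<close>
    show "{\<omega>\<in>space M. ereal (D t \<omega>) \<ge> min_plus T (\<lambda>\<tau>. A \<tau> \<omega>) S\<epsilon> t} \<in> sets M"
      using assms(10) t by blast
  qed
  finally show "1 - \<epsilon> \<le> \<P>(\<omega> in M. ereal (D t \<omega>) \<ge> min_plus T (\<lambda>\<tau>. A \<tau> \<omega>) S\<epsilon> t)" .
qed

end
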